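(* For a Tychonoff space $X$, the following assertions are equivalent: (i) $X$ is an $s_{\mathbb{R}}$-space; (ii) $X$ is strongly functionally generated by the family $\mathcal{S}(X)$ of all convergent sequences in $X$ with their limit points; (iii) $X$ is functionally generated by the family $\mathcal{S}(X)$; (iv) $X$ is strongly functionally generated by a family of $s_{\mathbb{R}}$-subspaces of $X$ (that is, by some cover of $X$ consisting of subspaces which are $s_{\mathbb{R}}$-spaces); (v) $X$ is an $R$-quotient image of $\mathbf{s}\times D$, where $D$ is a discrete space; (vi) $X$ is an $R$-quotient image of a metrizable locally compact space; (vii) $X$ is an $R$-quotient image of a sequential space; (viii) $X$ is an $R$-quotient image of an $s_{\mathbb{R}}$-space.
   Context: All spaces are assumed to be Tychonoff. A function $f:X\to\mathbb{R}$ is $s$-continuous (sequentially continuous) if its restriction to each convergent sequence in $X$ (together with its limit) is continuous. A space $X$ is an $s_{\mathbb{R}}$-space if every $s$-continuous function $f:X\to\mathbb{R}$ is continuous. $\mathbf{s}=\{\tfrac1n:n\in\mathbb{N}\}\cup\{0\}$ is the convergent sequence with the topology induced from $\mathbb{R}$. $\mathcal{S}(X)$ is the family of all sets of the form $\{x_n:n\}\cup\{x\}$ with $x_n\to x$ in $X$ (trivial sequences allowed, so it is a cover of $X$). A space is sequential if for each non-closed subset $A$ there is a sequence in $A$ converging to a point of $\overline{A}\setminus A$. Let $\mathcal{M}$ be a cover of $X$ by subsets of $X$. $X$ is strongly functionally generated by $\mathcal{M}$ if for each discontinuous function $f:X\to\mathbb{R}$ there is $M\in\mathcal{M}$ such that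 $f|_M:M\to\mathbb{R}$ is discontinuous. $X$ is functionally generated by $\mathcal{M}$ if for every discontinuous $f:X\to\mathbb{R}$ there is $M\in\mathcal{M}$ such that $f|_M$ cannot be extended to a real-valued continuous function on the whole space $X$. A map $p:Y\to X$ is $R$-quotient if it is continuous, onto, and every function $\phi:X\to\mathbb{R}$ is continuous whenever $\phi\circ p$ is continuous; then $X$ is called an $R$-quotient image of $Y$. *)

theory Defs
  imports "HOL-Analysis.Analysis"
begin

definition Tychonoff_space :: "'a topology \<Rightarrow> bool" where
  "Tychonoff_space X \<longleftrightarrow> completely_regular_space X \<and> Hausdorff_space X"

text \<open>The inclusion in \<open>topspace X\<close> is needed because \<^const>\<open>limitin\<close> constrains
  only a tail of the sequence.\<close>

definition convergent_sequences :: "'a topology \<Rightarrow> 'a set set" where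
  "convergent_sequences X =
     {insert l (range x) | (x :: nat \<Rightarrow> 'a) l. range x \<subseteq> topspace X \<and> limitin X x l sequentially}"

text \<open>A function on the space \<open>X\<close> is a total function on the type, of which only the values
  on \<open>topspace X\<close> matter.\<close>

definition s_continuous :: "'a topology \<Rightarrow> ('a \<Rightarrow> real) \<Rightarrow> bool" where
  "s_continuous X f \<longleftrightarrow>
     (\<forall>(x :: nat \<Rightarrow> 'a) l. range x \<subseteq> topspace X \<and> limitin X x l sequentially \<longrightarrow>
        continuous_map (subtopology X (insert l (range x))) euclideanreal f)"

definition s\<^sub>R_space :: "'a topology \<Rightarrow> bool" where
  "s\<^sub>R_space X \<longleftrightarrow> (\<forall>f. s_continuous X f \<longrightarrow> continuous_map X euclideanreal f)"

definition sequential_space :: "'a topology \<Rightarrow> bool" where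
  "sequential_space X \<longleftrightarrow>
     (\<forall>A \<subseteq> topspace X. \<not> closedin X A \<longrightarrow>
        (\<exists>(x :: nat \<Rightarrow> 'a) l. range x \<subseteq> A \<and> limitin X x l sequentially \<and>
           l \<in> (X closure_of A) - A))"

definition strongly_functionally_generated :: "'a topology \<Rightarrow> 'a set set \<Rightarrow> bool" where
  "strongly_functionally_generated X \<M> \<longleftrightarrow>
     \<Union>\<M> = topspace X \<and>
     (\<forall>f :: 'a \<Rightarrow> real. \<not> continuous_map X euclideanreal f \<longrightarrow>
        (\<exists>M \<in> \<M>. \<not> continuous_map (subtopology X M) euclideanreal f))"

definition functionally_generated :: "'a topology \<Rightarrow> 'a set set \<Rightarrow> bool" where
  "functionally_generated X \<M> \<longleftrightarrow>
     \<Union>\<M> = topspace X \<and>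
     (\<forall>f :: 'a \<Rightarrow> real. \<not> continuous_map X euclideanreal f \<longrightarrow>
        (\<exists>M \<in> \<M>. \<not> (\<exists>g. continuous_map X euclideanreal g \<and> (\<forall>x \<in> M. g x = f x))))"

definition R_quotient_map :: "'b topology \<Rightarrow> 'a topology \<Rightarrow> ('b \<Rightarrow> 'a) \<Rightarrow> bool" where
  "R_quotient_map Y X p \<longleftrightarrow>
     continuous_map Y X p \<and> p ` topspace Y = topspace X \<and>
     (\<forall>\<phi> :: 'a \<Rightarrow> real.
        continuous_map Y euclideanreal (\<phi> \<circ> p) \<longrightarrow> continuous_map X euclideanreal \<phi>)"

definition R_quotient_image :: "'b topology \<Rightarrow> 'a topology \<Rightarrow> bool" where
  "R_quotient_image Y X \<longleftrightarrow> (\<exists>p. R_quotient_map Y X p)"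

definition conv_seq :: "real topology" where
  "conv_seq = subtopology euclideanreal (insert 0 {1 / real n | n. n \<ge> 1})"

end

(* The convergent sequences with their limits are exactly the images of continuous maps from
   conv_seq, and each such map is a quotient map onto its image because conv_seq is compact and the
   target is Hausdorff.  Hence the sum over all these maps is an R-quotient map from a product of
   conv_seq with a discrete space as soon as s-continuity implies continuity.  Conversely,
   s-continuity is preserved by composition with continuous maps, so R-quotient images inherit the
   property.  Passing from functional to strong functional generation uses that a continuous function
   on a compact subset of a Tychonoff space extends to the whole space. *)

theory Submission
  imports Defs
begin

section \<open>s-continuity and convergent sequences\<close>

lemma s_continuousD:
  assumes "s_continuous X f" "range x \<subseteq> topspace X" "limitin X x l sequentially"
  shows "continuous_map (subtopology X (insert l (range x))) euclideanreal f"
  using assms by (simp add: s_continuous_def)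

lemma s_continuous_iff_convergent_sequences:
  "s_continuous X f \<longleftrightarrow>
    (\<forall>M \<in> convergent_sequences X. continuous_map (subtopology X M) euclideanreal f)"
  by (auto simp: s_continuous_def convergent_sequences_def)

lemma Union_convergent_sequences: "\<Union>(convergent_sequences X) = topspace X"
proof
  show "\<Union>(convergent_sequences X) \<subseteq> topspace X"
    unfolding convergent_sequences_def by (auto dest: limitin_topspace)
  show "topspace X \<subseteq> \<Union>(convergent_sequences X)"
  proof
    fix a assume a: "a \<in> topspace X"
    \<comment> \<open>The constant sequence at \<open>a\<close> places every point in a member of
      the family.\<close>
    then have "limitin X (\<lambda>_::nat. a) a sequentially"
      by (simp add: limitin_const_iff)
    with a have "insert a (range (\<lambda>_::nat. a)) \<in> convergent_sequences X"
      unfolding convergent_sequences_def by (intro CollectI exI conjI refl) auto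
    then show "a \<in> \<Union>(convergent_sequences X)"
      by blast
  qed
qed

text \<open>The sequence still converges when the space is cut down to its range and limit, and
  there \<open>f\<close> is continuous.\<close>

lemma s_continuous_limit:
  assumes "s_continuous X f" "range x \<subseteq> topspace X" "limitin X x l sequentially"
  shows "(\<lambda>n. f (x n)) \<longlonglongrightarrow> f l"
proof -
  have "limitin (subtopology X (insert l (range x))) x l sequentially"
    using assms by (simp add: limitin_subtopology)
  from continuous_map_limit[OF s_continuousD[OF assms] this] show ?thesis
    by (simp add: o_def)
qed

text \<open>A continuous map carries a convergent sequence with its limit onto another such set. The
  lemma is applied both to inclusions of subspaces and to R-quotient maps.\<close>

lemma s_continuous_compose:
  assumes "continuous_map Y X p" "s_continuous X f"
  shows "s_continuous Y (f \<circ> p)"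
  unfolding s_continuous_def
proof (intro allI impI)
  fix x :: "nat \<Rightarrow> 'a" and l
  assume xl: "range x \<subseteq> topspace Y \<and> limitin Y x l sequentially"
  have "limitin X (p \<circ> x) (p l) sequentially"
    using xl by (intro continuous_map_limit[OF assms(1)]) simp
  moreover have "range (p \<circ> x) \<subseteq> topspace X"
    using xl continuous_map_image_subset_topspace[OF assms(1)] by auto
  ultimately have *: "continuous_map (subtopology X (insert (p l) (range (p \<circ> x)))) euclideanreal f"
    by (intro s_continuousD[OF assms(2)])
  have "continuous_map (subtopology Y (insert l (range x)))
      (subtopology X (insert (p l) (range (p \<circ> x)))) p"
    using assms(1) by (auto simp: continuous_map_in_subtopology continuous_map_from_subtopology)
  then show "continuous_map (subtopology Y (insert l (range x))) euclideanreal (f \<circ> p)"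
    using * by (rule continuous_map_compose)
qed

section \<open>Functional generation and R-quotient images\<close>

lemma s\<^sub>R_space_iff_strongly_functionally_generated:
  "s\<^sub>R_space X \<longleftrightarrow> strongly_functionally_generated X (convergent_sequences X)"
  unfolding s\<^sub>R_space_def strongly_functionally_generated_def
    s_continuous_iff_convergent_sequences
  by (auto simp: Union_convergent_sequences)

text \<open>Compactness is what allows continuous functions on these sets to be extended to a
  completely regular space.\<close>

lemma compactin_convergent_sequences:
  "M \<in> convergent_sequences X \<Longrightarrow> compactin X M"
  unfolding convergent_sequences_def
  by (clarify, rule compactin_sequence_with_limit[OF _ subset_refl])

lemma s\<^sub>R_space_iff_functionally_generated:
  assumes "completely_regular_space X"
  shows "s\<^sub>R_space X \<longleftrightarrow> functionally_generated X (convergent_sequences X)"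
proof -
  \<comment> \<open>On compact members of the family, extendability and continuity of the
    restriction coincide, so the two notions of generation agree there.\<close>
  have ext: "(\<exists>g. continuous_map X euclideanreal g \<and> (\<forall>x \<in> M. g x = f x)) \<longleftrightarrow>
      continuous_map (subtopology X M) euclideanreal f"
    if M: "M \<in> convergent_sequences X" for M and f :: "'a \<Rightarrow> real"
  proof
    assume "\<exists>g. continuous_map X euclideanreal g \<and> (\<forall>x \<in> M. g x = f x)"
    then obtain g where g: "continuous_map X euclideanreal g" "\<And>x. x \<in> M \<Longrightarrow> g x = f x"
      by blast
    show "continuous_map (subtopology X M) euclideanreal f"
      by (rule continuous_map_eq[OF continuous_map_from_subtopology[OF g(1)]]) (use g in auto)
  next
    assume f: "continuous_map (subtopology X M) euclideanreal f"
    obtain g where "continuous_map X euclideanreal g" "\<And>x. x \<in> M \<Longrightarrow> g x = f x"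
      using Tietze_extension_completely_regular
        [OF assms compactin_convergent_sequences[OF M] is_interval_univ UNIV_not_empty f]
      by auto
    then show "\<exists>g. continuous_map X euclideanreal g \<and> (\<forall>x \<in> M. g x = f x)"
      by blast
  qed
  show ?thesis
    unfolding s\<^sub>R_space_iff_strongly_functionally_generated
      strongly_functionally_generated_def functionally_generated_def
    using ext by auto
qed

lemma s\<^sub>R_space_strongly_functionally_generated_subspaces:
  assumes gen: "strongly_functionally_generated X \<M>"
    and sub: "\<And>M. M \<in> \<M> \<Longrightarrow> s\<^sub>R_space (subtopology X M)"
  shows "s\<^sub>R_space X"
  unfolding s\<^sub>R_space_def
proof (intro allI impI)
  fix f assume f: "s_continuous X f"
  have "continuous_map (subtopology X M) euclideanreal f" if "M \<in> \<M>" for M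
    \<comment> \<open>The inclusion of \<open>M\<close> into \<open>X\<close> is \<open>id\<close>
      on the subspace, so the restriction of \<open>f\<close> to \<open>M\<close> is again
      s-continuous.\<close>
    using sub[OF that] s_continuous_compose[OF continuous_map_from_subtopology f, of X id M]
    by (simp add: s\<^sub>R_space_def)
  then show "continuous_map X euclideanreal f"
    using gen unfolding strongly_functionally_generated_def by blast
qed

text \<open>An s-continuous function pulls back along \<open>p\<close> to an s-continuous, hence
  continuous, function on \<open>Y\<close>; the R-quotient property brings continuity back to
  \<open>X\<close>.\<close>

lemma s\<^sub>R_space_R_quotient_image:
  assumes "R_quotient_image Y X" "s\<^sub>R_space Y"
  shows "s\<^sub>R_space X"
  unfolding s\<^sub>R_space_def
proof (intro allI impI)
  fix f assume f: "s_continuous X f"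
  obtain p where p: "R_quotient_map Y X p"
    using assms(1) by (auto simp: R_quotient_image_def)
  then have "s_continuous Y (f \<circ> p)"
    by (intro s_continuous_compose[OF _ f]) (simp add: R_quotient_map_def)
  then show "continuous_map X euclideanreal f"
    using assms(2) p by (simp add: s\<^sub>R_space_def R_quotient_map_def)
qed

section \<open>Sequential and metrizable spaces\<close>

lemma s\<^sub>R_space_sequential_space:
  assumes "sequential_space X"
  shows "s\<^sub>R_space X"
  unfolding s\<^sub>R_space_def continuous_map_closedin
proof (intro allI impI conjI)
  fix f :: "'a \<Rightarrow> real" and C :: "real set"
  assume f: "s_continuous X f" and C: "closedin euclidean C"
  let ?A = "{x \<in> topspace X. f x \<in> C}"
  show "closedin X ?A"
  proof (rule ccontr)
    assume "\<not> closedin X ?A"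
    then obtain x :: "nat \<Rightarrow> 'a" and l where x: "range x \<subseteq> ?A"
      and l: "limitin X x l sequentially" "l \<in> (X closure_of ?A) - ?A"
      using assms[unfolded sequential_space_def, rule_format, of ?A] by auto
    \<comment> \<open>A sequence leaving the preimage of \<open>C\<close> in the limit would force
      \<open>f l\<close> out of the closed set \<open>C\<close>.\<close>
    have "(\<lambda>n. f (x n)) \<longlonglongrightarrow> f l"
      using s_continuous_limit[OF f _ l(1)] x by blast
    with C have "f l \<in> C"
      using closed_sequentially[of C "\<lambda>n. f (x n)"] x by auto
    moreover have "l \<in> topspace X"
      by (rule limitin_topspace[OF l(1)])
    ultimately show False
      using l(2) by blast
  qed
qed auto

lemma metrizable_imp_sequential_space:
  assumes "metrizable_space X"
  shows "sequential_space X"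
  unfolding sequential_space_def
proof (intro allI impI)
  fix A assume A: "A \<subseteq> topspace X" "\<not> closedin X A"
  obtain M d where "Metric_space M d" and X: "X = Metric_space.mtopology M d"
    using assms unfolding metrizable_space_def by blast
  then interpret Metric_space M d by simp
  obtain x l where "range x \<subseteq> A" "limitin X x l sequentially" "l \<notin> A"
    using A X metric_closedin_iff_sequentially_closed[of A] by auto
  moreover from this have "l \<in> X closure_of A"
    using A(1) unfolding X closure_of_sequentially
    by (auto dest: limitin_topspace)
  ultimately show "\<exists>x l. range x \<subseteq> A \<and> limitin X x l sequentially \<and> l \<in> X closure_of A - A"
    by blast
qed

lemma metrizable_imp_Tychonoff_space: "metrizable_space X \<Longrightarrow> Tychonoff_space X"
  by (simp add: Tychonoff_space_def metrizable_imp_completely_regular_space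
      metrizable_imp_Hausdorff_space)

(* The index 0 yields the limit point, because 1 / 0 = 0. *)
lemma conv_seq_eq: "conv_seq = top_of_set (range (\<lambda>n. 1 / real n))"
proof -
  have "insert 0 {1 / real n | n. n \<ge> 1} = range (\<lambda>n. 1 / real n)"
  proof (intro equalityI subsetI)
    fix t assume "t \<in> insert 0 {1 / real n | n. n \<ge> 1}"
    then show "t \<in> range (\<lambda>n. 1 / real n)"
      by (auto intro: image_eqI[where x = 0])
  next
    fix t assume "t \<in> range (\<lambda>n. 1 / real n)"
    then obtain n where "t = 1 / real n" by blast
    then show "t \<in> insert 0 {1 / real n | n. n \<ge> 1}"
      by (cases "n = 0") auto
  qed
  then show ?thesis
    by (simp add: conv_seq_def)
qed

lemma topspace_conv_seq: "topspace conv_seq = range (\<lambda>n. 1 / real n)"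
  by (simp add: conv_seq_eq)

section \<open>Compactness and open sets of \<open>conv_seq\<close>\<close>

lemma metrizable_space_conv_seq: "metrizable_space conv_seq"
  by (simp add: conv_seq_eq metrizable_space_euclidean metrizable_space_subtopology)

lemma compact_space_conv_seq: "compact_space conv_seq"
proof -
  have "limitin euclideanreal (\<lambda>n. 1 / real n) 0 sequentially"
    by (simp add: lim_1_over_n)
  from compactin_sequence_with_limit[OF this subset_refl]
  have "compactin euclideanreal (insert 0 (range (\<lambda>n. 1 / real n)))"
    by simp
  moreover have "insert 0 (range (\<lambda>n. 1 / real n)) = range (\<lambda>n. 1 / real n)"
    by (auto intro: image_eqI[where x = 0])
  ultimately show ?thesis
    unfolding conv_seq_eq by (simp add: compact_space_subtopology)
qed

lemma openin_conv_seq_cofinite: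
  assumes "V \<subseteq> topspace conv_seq" "finite (topspace conv_seq - V)"
  shows "openin conv_seq V"
proof -
  have "closedin conv_seq (topspace conv_seq - V)"
    using assms(2) metrizable_imp_Hausdorff_space[OF metrizable_space_conv_seq]
    by (simp add: closedin_Hausdorff_finite)
  then show ?thesis
    using assms(1) by (simp add: openin_closedin_eq)
qed

lemma openin_conv_seq_singleton:
  assumes "n \<noteq> 0"
  shows "openin conv_seq {1 / real n}"
proof -
  \<comment> \<open>The ray discards all terms of index above \<open>n\<close> and also 0, the term
    of index 0; removing a finite set discards the indices below \<open>n\<close>.\<close>
  let ?U = "{1 / real (Suc n)<..} - (\<lambda>m. 1 / real m) ` {..<n}"
  have "1 / real n \<in> ?U"
    using assms by (auto simp: divide_simps split: if_splits)
  then have "{1 / real n} \<subseteq> range (\<lambda>m. 1 / real m) \<inter> ?U"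
    by simp
  moreover have "open ?U"
    by (intro open_Diff finite_imp_closed) auto
  moreover have "range (\<lambda>m. 1 / real m) \<inter> ?U \<subseteq> {1 / real n}"
  proof
    fix t assume "t \<in> range (\<lambda>m. 1 / real m) \<inter> ?U"
    then obtain m where m: "t = 1 / real m" "1 / real (Suc n) < 1 / real m" "\<not> m < n"
      by auto
    then have "m < Suc n"
      using assms by (auto simp: field_simps split: if_splits)
    with m show "t \<in> {1 / real n}"
      by (simp add: less_Suc_eq)
  qed
  ultimately show ?thesis
    unfolding conv_seq_eq by (metis openin_open_Int subset_antisym)
qed

text \<open>Openness is a condition at the limit point only: a set containing 0 is cofinite by the
  second assumption, and any other set is a union of isolated points.\<close>

lemma openin_conv_seq:
  assumes "V \<subseteq> topspace conv_seq" "0 \<in> V \<Longrightarrow> \<forall>\<^sub>F n in sequentially. 1 / real n \<in> V"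
  shows "openin conv_seq V"
proof (cases "0 \<in> V")
  case True
  then obtain N where N: "\<And>n. n \<ge> N \<Longrightarrow> 1 / real n \<in> V"
    using assms(2) by (auto simp: eventually_sequentially)
  have "topspace conv_seq - V \<subseteq> (\<lambda>n. 1 / real n) ` {..<N}"
    using N by (force simp: topspace_conv_seq not_le[symmetric])
  with assms(1) show ?thesis
    by (intro openin_conv_seq_cofinite) (auto intro: finite_subset)
next
  case False
  have "openin conv_seq {t}" if "t \<in> V" for t
  proof -
    have "t \<in> range (\<lambda>n. 1 / real n)"
      using assms(1) that unfolding topspace_conv_seq by blast
    then obtain n where "t = 1 / real n"
      by blast
    with False that show ?thesis
      by (metis div_by_0 of_nat_0 openin_conv_seq_singleton)
  qed
  then show ?thesis
    by (subst openin_subopen) blast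
qed

(* Since 1 / 0 = 0, this extends the map sending 1 / n to y n by the value y 0 at 0:
   sequences are encoded together with their limit, which is their term of index 0. *)
definition sequence_map :: "(nat \<Rightarrow> 'a) \<Rightarrow> real \<Rightarrow> 'a" where
  "sequence_map y t = y (nat \<lfloor>1 / t\<rfloor>)"

lemma sequence_map_one_over [simp]: "sequence_map y (1 / real n) = y n"
  by (simp add: sequence_map_def)

lemma sequence_map_image: "sequence_map y ` topspace conv_seq = range y"
  by (simp add: topspace_conv_seq image_image)

section \<open>Maps out of \<open>conv_seq\<close> and its products with discrete spaces\<close>

lemma continuous_map_sequence_map:
  assumes "range y \<subseteq> topspace X" "limitin X y (y 0) sequentially"
  shows "continuous_map conv_seq X (sequence_map y)"
  unfolding continuous_map_def
proof (intro conjI allI impI)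
  show "sequence_map y \<in> topspace conv_seq \<rightarrow> topspace X"
    using assms(1) sequence_map_image[of y] by blast
  fix U assume U: "openin X U"
  show "openin conv_seq {t \<in> topspace conv_seq. sequence_map y t \<in> U}"
  proof (rule openin_conv_seq)
    assume "0 \<in> {t \<in> topspace conv_seq. sequence_map y t \<in> U}"
    then have "y 0 \<in> U"
      by (simp add: sequence_map_def)
    with assms(2) U have "\<forall>\<^sub>F n in sequentially. y n \<in> U"
      by (simp add: limitin_def)
    then show "\<forall>\<^sub>F n in sequentially. 1 / real n \<in> {t \<in> topspace conv_seq. sequence_map y t \<in> U}"
      by eventually_elim (simp add: topspace_conv_seq)
  qed auto
qed

text \<open>A continuous surjection from a compact space onto a Hausdorff space is a quotient map.
  Continuity on the range of \<open>y\<close> can thus be tested on \<open>conv_seq\<close>.\<close>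

lemma quotient_map_sequence_map:
  assumes "Hausdorff_space X" "range y \<subseteq> topspace X" "limitin X y (y 0) sequentially"
  shows "quotient_map conv_seq (subtopology X (range y)) (sequence_map y)"
proof (rule continuous_imp_quotient_map)
  show "continuous_map conv_seq (subtopology X (range y)) (sequence_map y)"
    using continuous_map_sequence_map[OF assms(2,3)] sequence_map_image[of y]
    by (auto simp: continuous_map_in_subtopology)
  show "sequence_map y ` topspace conv_seq = topspace (subtopology X (range y))"
    using assms(2) by (simp add: sequence_map_image inf.absorb2)
qed (use assms(1) in \<open>auto simp: compact_space_conv_seq Hausdorff_space_subtopology\<close>)

text \<open>The slices over single points of \<open>D\<close> are open, so continuity can be checked
  slice by slice.\<close>

lemma continuous_map_prod_discrete_topology:
  assumes "\<And>d. d \<in> D \<Longrightarrow> continuous_map Y X (\<lambda>t. p (t, d))"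
  shows "continuous_map (prod_topology Y (discrete_topology D)) X p"
  unfolding continuous_map_def
proof (intro conjI allI impI)
  show "p \<in> topspace (prod_topology Y (discrete_topology D)) \<rightarrow> topspace X"
    using assms by (auto simp: continuous_map_def)
  fix U assume "openin X U"
  then have "openin (prod_topology Y (discrete_topology D)) ({t \<in> topspace Y. p (t, d) \<in> U} \<times> {d})"
    if "d \<in> D" for d
    using assms[OF that] that by (simp add: openin_prod_Times_iff continuous_map_def)
  moreover have "{z \<in> topspace (prod_topology Y (discrete_topology D)). p z \<in> U} =
      (\<Union>d\<in>D. {t \<in> topspace Y. p (t, d) \<in> U} \<times> {d})"
    by auto
  ultimately show
    "openin (prod_topology Y (discrete_topology D)) {z \<in> topspace (prod_topology Y (discrete_topology D)). p z \<in> U}"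
    by auto
qed

lemma s\<^sub>R_space_imp_R_quotient_image_conv_seq:
  fixes X :: "'a topology"
  assumes "Hausdorff_space X" "s\<^sub>R_space X"
  shows "\<exists>D :: (nat \<Rightarrow> 'a) set. R_quotient_image (prod_topology conv_seq (discrete_topology D)) X"
proof -
  \<comment> \<open>The index set consists of all convergent sequences of \<open>X\<close>, each
    carrying its limit at index 0; \<open>p\<close> runs along the sequence named by the second
    coordinate.\<close>
  define D where "D = {y. range y \<subseteq> topspace X \<and> limitin X y (y 0) sequentially}"
  define p where "p = (\<lambda>(t, y :: nat \<Rightarrow> 'a). sequence_map y t)"
  let ?Y = "prod_topology conv_seq (discrete_topology D)"
  have "continuous_map ?Y X p"
    by (rule continuous_map_prod_discrete_topology)
      (auto simp: p_def D_def intro: continuous_map_sequence_map)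
  moreover have "p ` topspace ?Y = topspace X"
  proof -
    have "p ` topspace ?Y = (\<Union>y\<in>D. sequence_map y ` topspace conv_seq)"
      by (force simp: p_def)
    also have "\<dots> = (\<Union>y\<in>D. range y)"
      by (simp add: sequence_map_image)
    also have "\<dots> = topspace X"
    proof
      show "topspace X \<subseteq> (\<Union>y\<in>D. range y)"
      proof
        fix a assume "a \<in> topspace X"
        then have "(\<lambda>_. a) \<in> D"
          by (simp add: D_def limitin_const_iff)
        then show "a \<in> (\<Union>y\<in>D. range y)"
          by blast
      qed
    qed (auto simp: D_def)
    finally show ?thesis .
  qed
  moreover have "continuous_map X euclideanreal \<phi>"
    if \<phi>: "continuous_map ?Y euclideanreal (\<phi> \<circ> p)" for \<phi>
  proof -
    have "s_continuous X \<phi>"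
      unfolding s_continuous_def
    proof (intro allI impI)
      fix x :: "nat \<Rightarrow> 'a" and l
      assume xl: "range x \<subseteq> topspace X \<and> limitin X x l sequentially"
      \<comment> \<open>The limit is prepended at index 0 and the terms move up by one, which turns
        the given sequence into an element of \<open>D\<close>.\<close>
      define y where "y = case_nat l x"
      have range: "range y = insert l (range x)"
        unfolding y_def by (subst UNIV_nat_eq) (simp add: image_image)
      have "limitin X (\<lambda>n. y (n + 1)) l sequentially"
        using xl by (simp add: y_def)
      then have "limitin X y (y 0) sequentially"
        using limitin_sequentially_offset_rev[of X y 1 l] by (simp add: y_def)
      moreover have "range y \<subseteq> topspace X"
        using xl limitin_topspace[of X x l] unfolding range by blast
      ultimately have y: "range y \<subseteq> topspace X" "limitin X y (y 0) sequentially"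
        by auto
      then have "y \<in> D"
        by (simp add: D_def)
      \<comment> \<open>Along the slice at \<open>y\<close> the map \<open>p\<close> is just
        \<open>sequence_map y\<close>, so continuity of \<open>\<phi> \<circ> p\<close> reaches this
        one sequence.\<close>
      then have "continuous_map conv_seq ?Y (\<lambda>t. (t, y))"
        by (simp add: continuous_map_pairedI)
      from continuous_map_compose[OF this \<phi>]
      have "continuous_map conv_seq euclideanreal (\<phi> \<circ> sequence_map y)"
        by (simp add: p_def o_def)
      with quotient_map_sequence_map[OF assms(1) y]
      show "continuous_map (subtopology X (insert l (range x))) euclideanreal \<phi>"
        unfolding range[symmetric] by (rule continuous_compose_quotient_map)
    qed
    with assms(2) show ?thesis
      by (simp add: s\<^sub>R_space_def)
  qed
  ultimately show ?thesis
    unfolding R_quotient_image_def R_quotient_map_def by blast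
qed

section \<open>Assembling the equivalences\<close>

lemma metrizable_space_conv_seq_discrete:
  "metrizable_space (prod_topology conv_seq (discrete_topology D))"
  by (simp add: metrizable_space_prod_topology metrizable_space_conv_seq)

lemma locally_compact_space_conv_seq_discrete:
  "locally_compact_space (prod_topology conv_seq (discrete_topology D))"
  by (simp add: locally_compact_space_prod_topology compact_imp_locally_compact_space
      compact_space_conv_seq locally_compact_space_discrete_topology)

lemma metrizable_imp_s\<^sub>R_space: "metrizable_space X \<Longrightarrow> s\<^sub>R_space X"
  by (simp add: metrizable_imp_sequential_space s\<^sub>R_space_sequential_space)

lemma s\<^sub>R_space_R_quotient_image_metrizable:
  "R_quotient_image Y X \<Longrightarrow> metrizable_space Y \<Longrightarrow> s\<^sub>R_space X"
  by (erule s\<^sub>R_space_R_quotient_image) (rule metrizable_imp_s\<^sub>R_space)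

lemma s\<^sub>R_space_R_quotient_image_sequential:
  "R_quotient_image Y X \<Longrightarrow> sequential_space Y \<Longrightarrow> s\<^sub>R_space X"
  by (erule s\<^sub>R_space_R_quotient_image) (rule s\<^sub>R_space_sequential_space)

lemma s\<^sub>R_space_R_quotient_image_conv_seq:
  "R_quotient_image (prod_topology conv_seq (discrete_topology D)) X \<Longrightarrow> s\<^sub>R_space X"
  by (erule s\<^sub>R_space_R_quotient_image_metrizable) (rule metrizable_space_conv_seq_discrete)

theorem theorem7p1:
  fixes X :: "'a topology"
  assumes "Tychonoff_space X"
  shows
    "((s\<^sub>R_space X \<longleftrightarrow> strongly_functionally_generated X (convergent_sequences X)) \<and>
      (s\<^sub>R_space X \<longleftrightarrow> functionally_generated X (convergent_sequences X)) \<and>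
      (s\<^sub>R_space X \<longleftrightarrow>
         (\<exists>\<M>. strongly_functionally_generated X \<M> \<and> (\<forall>M \<in> \<M>. s\<^sub>R_space (subtopology X M)))) \<and>
      (s\<^sub>R_space X \<longleftrightarrow>
         (\<exists>D :: (nat \<Rightarrow> 'a) set. R_quotient_image (prod_topology conv_seq (discrete_topology D)) X)) \<and>
      (s\<^sub>R_space X \<longleftrightarrow>
         (\<exists>Y :: (real \<times> (nat \<Rightarrow> 'a)) topology.
            metrizable_space Y \<and> locally_compact_space Y \<and> R_quotient_image Y X)) \<and>
      (s\<^sub>R_space X \<longleftrightarrow>
         (\<exists>Y :: (real \<times> (nat \<Rightarrow> 'a)) topology.
            Tychonoff_space Y \<and> sequential_space Y \<and> R_quotient_image Y X)) \<and>
      (s\<^sub>R_space X \<longleftrightarrow>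
         (\<exists>Y :: (real \<times> (nat \<Rightarrow> 'a)) topology.
            Tychonoff_space Y \<and> s\<^sub>R_space Y \<and> R_quotient_image Y X)))
     \<and>
     \<comment> \<open>HOL cannot quantify over types inside a formula. The types above are large enough to contain
       witnesses; the following implications, with arbitrary types \<open>'d\<close>, \<open>'e\<close>, \<open>'f\<close>, \<open>'g\<close>,
       show that witnesses of any other type are equally good.\<close>
     (((\<exists>D :: 'd set. R_quotient_image (prod_topology conv_seq (discrete_topology D)) X)
         \<longrightarrow> s\<^sub>R_space X) \<and>
      ((\<exists>Y :: 'e topology. metrizable_space Y \<and> locally_compact_space Y \<and> R_quotient_image Y X)
         \<longrightarrow> s\<^sub>R_space X) \<and>
      ((\<exists>Y :: 'f topology. Tychonoff_space Y \<and> sequential_space Y \<and> R_quotient_image Y X)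
         \<longrightarrow> s\<^sub>R_space X) \<and>
      ((\<exists>Y :: 'g topology. Tychonoff_space Y \<and> s\<^sub>R_space Y \<and> R_quotient_image Y X)
         \<longrightarrow> s\<^sub>R_space X))"
proof -
  have H: "Hausdorff_space X" and CR: "completely_regular_space X"
    using assms by (auto simp: Tychonoff_space_def)
  have ex: "\<exists>D :: (nat \<Rightarrow> 'a) set. R_quotient_image (prod_topology conv_seq (discrete_topology D)) X"
    if "s\<^sub>R_space X"
    using s\<^sub>R_space_imp_R_quotient_image_conv_seq[OF H that] .
  have ii: "s\<^sub>R_space X \<longleftrightarrow> strongly_functionally_generated X (convergent_sequences X)"
    by (rule s\<^sub>R_space_iff_strongly_functionally_generated)
  have iii: "s\<^sub>R_space X \<longleftrightarrow> functionally_generated X (convergent_sequences X)"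
    by (rule s\<^sub>R_space_iff_functionally_generated[OF CR])
  have iv: "s\<^sub>R_space X \<longleftrightarrow>
      (\<exists>\<M>. strongly_functionally_generated X \<M> \<and> (\<forall>M \<in> \<M>. s\<^sub>R_space (subtopology X M)))"
  proof
    assume "s\<^sub>R_space X"
    then show "\<exists>\<M>. strongly_functionally_generated X \<M> \<and> (\<forall>M \<in> \<M>. s\<^sub>R_space (subtopology X M))"
      \<comment> \<open>The cover with the whole space as its only member suffices.\<close>
      by (intro exI[of _ "{topspace X}"]) (simp add: strongly_functionally_generated_def)
  qed (auto intro: s\<^sub>R_space_strongly_functionally_generated_subspaces)
  have vi: "\<exists>Y :: (real \<times> (nat \<Rightarrow> 'a)) topology.
      metrizable_space Y \<and> locally_compact_space Y \<and> R_quotient_image Y X"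
    if "s\<^sub>R_space X"
    using ex[OF that] metrizable_space_conv_seq_discrete locally_compact_space_conv_seq_discrete
    by blast
  \<comment> \<open>The metrizable witness also serves here and in \<open>viii\<close>: metrizable
    spaces are Tychonoff and sequential, and sequential spaces are
    \<open>s\<^sub>R_space\<close>s.\<close>
  then have vii: "\<exists>Y :: (real \<times> (nat \<Rightarrow> 'a)) topology.
      Tychonoff_space Y \<and> sequential_space Y \<and> R_quotient_image Y X"
    if "s\<^sub>R_space X"
    using that metrizable_imp_Tychonoff_space metrizable_imp_sequential_space by blast
  then have viii: "\<exists>Y :: (real \<times> (nat \<Rightarrow> 'a)) topology.
      Tychonoff_space Y \<and> s\<^sub>R_space Y \<and> R_quotient_image Y X"
    if "s\<^sub>R_space X"
    using that s\<^sub>R_space_sequential_space by blast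
  note quotients = s\<^sub>R_space_R_quotient_image_conv_seq s\<^sub>R_space_R_quotient_image_metrizable
    s\<^sub>R_space_R_quotient_image_sequential s\<^sub>R_space_R_quotient_image
  have v_iff: "s\<^sub>R_space X \<longleftrightarrow>
      (\<exists>D :: (nat \<Rightarrow> 'a) set. R_quotient_image (prod_topology conv_seq (discrete_topology D)) X)"
    by (rule iffI, erule ex, elim exE, erule quotients(1))
  have vi_iff: "s\<^sub>R_space X \<longleftrightarrow> (\<exists>Y :: (real \<times> (nat \<Rightarrow> 'a)) topology.
      metrizable_space Y \<and> locally_compact_space Y \<and> R_quotient_image Y X)"
    by (rule iffI, erule vi, elim exE conjE, erule (1) quotients(2))
  have vii_iff: "s\<^sub>R_space X \<longleftrightarrow> (\<exists>Y :: (real \<times> (nat \<Rightarrow> 'a)) topology.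
      Tychonoff_space Y \<and> sequential_space Y \<and> R_quotient_image Y X)"
    by (rule iffI, erule vii, elim exE conjE, erule (1) quotients(3))
  have viii_iff: "s\<^sub>R_space X \<longleftrightarrow> (\<exists>Y :: (real \<times> (nat \<Rightarrow> 'a)) topology.
      Tychonoff_space Y \<and> s\<^sub>R_space Y \<and> R_quotient_image Y X)"
    by (rule iffI, erule viii, elim exE conjE, erule (1) quotients(4))
  show ?thesis
    by (intro conjI impI ii iii iv v_iff vi_iff vii_iff viii_iff; elim exE conjE)
      (erule quotients(1), erule (1) quotients(2), erule (1) quotients(3), erule (1) quotients(4))
qed

end
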